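(* Let $d\ge 1$, let $p_1,p_2,\ldots,p_d$ be fixed different primes, and let $n_1<n_2<\ldots$ be the increasing sequence formed by all the numbers $$p_1^{k_1}p_2^{k_2}\cdots p_d^{k_d},\qquad k_1,k_2,\ldots,k_d\in\mathbb{N}.$$ If an increasing function $\phi:\mathbb{R}^+\to\mathbb{R}^+$ satisfies $$\lim_{x\to\infty}\frac{\phi(x)}{x\ln^{d-1}x}=0,$$ then there exists a function $f\in L^\phi(\mathbb{T})$ such that the sequence $R_{n_k}f(x)$ is divergent for every $x\in\mathbb{T}$.
   Context: $\mathbb{T}=\mathbb{R}/\mathbb{Z}=[0,1)$ is the torus with Lebesgue measure. For a function $f$ on $\mathbb{T}$ and a positive integer $n$, the Riemann sum is $R_nf(x)=\frac1n\sum_{k=0}^{n-1}f\left(x+\frac kn\right)$, $x\in\mathbb{T}$. $L^\phi=L^\phi(\mathbb{T})$ denotes the class of (measurable) functions $f$ on $\mathbb{T}$ with $\phi(|f|)\in L^1(\mathbb{T})$. Divergent means not convergent to a finite limit. *)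

theory Defs
  imports "HOL-Analysis.Analysis" "HOL-Computational_Algebra.Primes"
begin

text \<open>
  Functions on the torus are represented by 1-periodic functions on the real line,
  and the measure on the torus is Lebesgue measure on the fundamental domain.
\<close>

abbreviation torus :: "real measure" where
  "torus \<equiv> lebesgue_on {0..<1}"

definition riemann_sum :: "nat \<Rightarrow> (real \<Rightarrow> real) \<Rightarrow> real \<Rightarrow> real" where
  "riemann_sum n f x = 1 / real n * (\<Sum>k<n. f (x + real k / real n))"

text \<open>
  Only the values of \<open>\<phi>\<close> on \<open>{0..}\<close> matter. Measurability of \<open>f\<close> is required separately,
  since it does not follow from that of \<open>\<lambda>x. \<phi> \<bar>f x\<bar>\<close>.
\<close>

definition L_class :: "(real \<Rightarrow> real) \<Rightarrow> (real \<Rightarrow> real) set" where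
  "L_class \<phi> = {f. (\<forall>x. f (x + 1) = f x) \<and> f \<in> borel_measurable torus
      \<and> integrable torus (\<lambda>x. \<phi> \<bar>f x\<bar>)}"

end

theory Submission
  imports Defs "HOL-Number_Theory.Totient" "HOL-Real_Asymp.Real_Asymp"
begin

text \<open>
  Let \<open>S\<close> be the multiplicative semigroup generated by the primes, and \<open>f = a\<close> on a set \<open>F\<close>. Then
  \<open>R\<^sub>n f \<ge> a / n\<close> on \<open>F + \<int> / n\<close>, so with \<open>a = A M\<close> some \<open>R\<^sub>n f\<close> is at least \<open>A\<close> on the union of the sets
  \<open>F + \<int> / n\<close> over \<open>n \<in> S\<close>, \<open>n \<le> M\<close>. Up to a constant there are \<open>(ln M)\<^bsup>d-1\<^esup>\<close> elements of \<open>S\<close> of size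
  comparable to \<open>M\<close>, and each contributes \<open>totient n\<close>, comparable to \<open>M\<close>, new reduced fractions. Hence a
  greedily chosen \<open>F\<close> of measure \<open>O(s / (M (ln M)\<^bsup>d-1\<^esup>))\<close> covers all but \<open>exp (- s)\<close> of the torus in
  this way, and its cost \<open>\<phi> (A M) |F|\<close> is negligible by the hypothesis on \<open>\<phi>\<close>. The supremum of countably many
  such functions has unbounded Riemann sums almost everywhere by Borel-Cantelli. The exceptional set is
  enlarged to a null set invariant under rational translations; there \<open>f\<close> is redefined on each
  coset of the rationals by the squared denominator, which also makes the Riemann sums unbounded.
\<close>

section \<open>Greedy covering of a cyclic group\<close>

text \<open>Averaging over \<open>t\<close>: for fixed \<open>x\<close> the residues of
  \<open>x + u\<close> with \<open>u\<close> in \<open>U\<close> are distinct, so the cardinalities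
  on the right, summed over all \<open>t\<close>, give exactly
  \<open>card B * card U\<close>.\<close>

lemma exists_large_translate:
  fixes q :: int
  assumes "q > 0" "U \<subseteq> {0..<q}" "B \<subseteq> {0..<q}"
  shows "\<exists>t\<in>{0..<q}. real (card B) * real (card U) \<le> real_of_int q * real (card {x\<in>B. \<exists>u\<in>U. (x + u) mod q = t})"
proof (rule ccontr)
  define c where "c t = card {x\<in>B. \<exists>u\<in>U. (x + u) mod q = t}" for t
  assume "\<not> ?thesis"
  then have less: "real_of_int q * real (c t) < real (card B) * real (card U)" if "t \<in> {0..<q}" for t
    using that unfolding c_def by force
  have fin: "finite B" "finite U" using assms(2,3) finite_subset by blast+
  have inj: "inj_on (\<lambda>u. (x + u) mod q) U" for x
  proof (rule inj_onI)
    fix u v assume uv: "u \<in> U" "v \<in> U" "(x + u) mod q = (x + v) mod q"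
    then have "u mod q = v mod q" by (metis add_diff_cancel_left' mod_diff_left_eq)
    with uv(1,2) assms(2) show "u = v" by (auto simp: subset_iff)
  qed
  have "(\<Sum>t\<in>{0..<q}. c t) = (\<Sum>t\<in>{0..<q}. \<Sum>x\<in>B. if \<exists>u\<in>U. (x + u) mod q = t then 1 else 0)"
    unfolding c_def by (intro sum.cong refl) (simp add: fin sum.If_cases Int_def)
  also have "\<dots> = (\<Sum>x\<in>B. \<Sum>t\<in>{0..<q}. if \<exists>u\<in>U. (x + u) mod q = t then 1 else 0)"
    by (rule sum.swap)
  also have "\<dots> = (\<Sum>x\<in>B. card ((\<lambda>u. (x + u) mod q) ` U))"
  proof (intro sum.cong refl)
    fix x
    have "{t\<in>{0..<q}. \<exists>u\<in>U. (x + u) mod q = t} = (\<lambda>u. (x + u) mod q) ` U"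
      using assms(1) by auto
    then show "(\<Sum>t\<in>{0..<q}. if \<exists>u\<in>U. (x + u) mod q = t then 1 else 0) = card ((\<lambda>u. (x + u) mod q) ` U)"
      by (simp add: sum.If_cases Int_def)
  qed
  also have "\<dots> = card B * card U"
    by (simp add: card_image[OF inj])
  finally have tot: "(\<Sum>t\<in>{0..<q}. c t) = card B * card U" .
  have "(\<Sum>t\<in>{0..<q}. real_of_int q * real (c t)) < (\<Sum>t\<in>{0..<q}. real (card B) * real (card U))"
    using assms(1) less by (intro sum_strict_mono) auto
  also have "\<dots> = real_of_int q * (real (card B) * real (card U))" using assms(1) by simp
  also have "(\<Sum>t\<in>{0..<q}. real_of_int q * real (c t)) = real_of_int q * real (\<Sum>t\<in>{0..<q}. c t)"
    by (simp add: sum_distrib_left)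
  finally show False using tot by simp
qed

text \<open>By averaging, some residue added to \<open>V\<close> takes care of at least the
  proportion \<open>card U / q\<close> of the points still uncovered, so the uncovered part decays
  geometrically in the number of steps.\<close>

lemma greedy_cover:
  fixes q :: int
  assumes "q > 0" "U \<subseteq> {0..<q}"
  shows "\<exists>V\<subseteq>{0..<q}. card V \<le> J \<and>
    real (card {x\<in>{0..<q}. \<forall>u\<in>U. (x + u) mod q \<notin> V}) \<le> real_of_int q * (1 - real (card U) / real_of_int q) ^ J"
proof (induction J)
  case 0
  have "{x\<in>{0..<q}. \<forall>u\<in>U. (x + u) mod q \<notin> {}} = {0..<q}" by auto
  then show ?case using assms(1) by (intro exI[of _ "{}"]) simp
next
  case (Suc J)
  then obtain V where V: "V \<subseteq> {0..<q}" "card V \<le> J"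
    "real (card {x\<in>{0..<q}. \<forall>u\<in>U. (x + u) mod q \<notin> V}) \<le> real_of_int q * (1 - real (card U) / real_of_int q) ^ J"
    by blast
  define B where "B = {x\<in>{0..<q}. \<forall>u\<in>U. (x + u) mod q \<notin> V}"
  have finB: "finite B" unfolding B_def by (rule finite_subset[of _ "{0..<q}"]) auto
  have V': "finite V" using V(1) finite_subset by blast
  obtain t where t: "t \<in> {0..<q}"
    "real (card B) * real (card U) \<le> real_of_int q * real (card {x\<in>B. \<exists>u\<in>U. (x + u) mod q = t})"
    using exists_large_translate[OF assms, of B] unfolding B_def by blast
  define D where "D = {x\<in>B. \<exists>u\<in>U. (x + u) mod q = t}"
  have "{x\<in>{0..<q}. \<forall>u\<in>U. (x + u) mod q \<notin> insert t V} = B - D"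
    unfolding B_def D_def by auto
  then have c: "card {x\<in>{0..<q}. \<forall>u\<in>U. (x + u) mod q \<notin> insert t V} = card B - card D"
    using finB by (simp add: D_def card_Diff_subset)
  have "card D \<le> card B" unfolding D_def using finB by (auto intro: card_mono)
  with c have "real (card {x\<in>{0..<q}. \<forall>u\<in>U. (x + u) mod q \<notin> insert t V}) = real (card B) - real (card D)"
    by simp
  also have "\<dots> \<le> real (card B) * (1 - real (card U) / real_of_int q)"
    using t(2) assms(1) unfolding D_def by (simp add: field_simps)
  also have "\<dots> \<le> (real_of_int q * (1 - real (card U) / real_of_int q) ^ J) * (1 - real (card U) / real_of_int q)"
  proof (rule mult_right_mono)
    have "card U \<le> card {0..<q}" using assms(2) by (intro card_mono) auto
    then show "0 \<le> 1 - real (card U) / real_of_int q" using assms(1) by (simp add: field_simps)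
  qed (use V(3) B_def in simp)
  finally show ?case
    using V(1,2) t(1) V'
    by (intro exI[of _ "insert t V"]) (auto simp: card_insert_if V' algebra_simps)
qed

lemma efficient_cover:
  fixes q :: int and s :: real
  assumes "q > 0" "U \<subseteq> {0..<q}" "U \<noteq> {}" "s \<ge> 0"
  obtains V where "V \<subseteq> {0..<q}" "real (card V) / q \<le> (s + 1) / card U"
    "real (card {x\<in>{0..<q}. \<forall>u\<in>U. (x + u) mod q \<notin> V}) / q \<le> exp (- s)"
proof -
  \<comment> \<open>This many steps suffice because \<open>1 - t \<le> exp (- t)\<close> with
    \<open>t = card U / q\<close>, so that \<open>J * t \<ge> s\<close>.\<close>
  define J where "J = nat \<lceil>s * q / card U\<rceil>"
  have fin: "finite U" using assms(2) finite_subset by blast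
  have cU: "card U > 0" using fin assms(3) by (simp add: card_gt_0_iff)
  have "card U \<le> card {0..<q}" using assms(2) by (intro card_mono) auto
  then have le: "real (card U) \<le> q" using assms(1) by simp
  have nn: "s * q / card U \<ge> 0" using assms by simp
  have J: "real J \<ge> s * q / card U" "real J \<le> s * q / card U + 1"
    unfolding J_def using nn by linarith+
  obtain V where V: "V \<subseteq> {0..<q}" "card V \<le> J"
    "real (card {x\<in>{0..<q}. \<forall>u\<in>U. (x + u) mod q \<notin> V}) \<le> real_of_int q * (1 - real (card U) / real_of_int q) ^ J"
    using greedy_cover[OF assms(1,2)] by blast
  show ?thesis
  proof
    show "V \<subseteq> {0..<q}" by fact
    have "real (card V) \<le> s * q / card U + 1" using J(2) V(2) by linarith
    \<comment> \<open>Rounding up costs one residue, absorbed by \<open>card U \<le> q\<close>; this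
      is the 1 in \<open>s + 1\<close>.\<close>
    also have "\<dots> \<le> s * q / card U + q / card U" using le cU by simp
    finally show "real (card V) / q \<le> (s + 1) / card U"
      using assms(1) cU by (simp add: field_simps)
    have "real (card {x\<in>{0..<q}. \<forall>u\<in>U. (x + u) mod q \<notin> V}) / q \<le> (1 - real (card U) / real_of_int q) ^ J"
      using V(3) assms(1) by (simp add: field_simps)
    also have "\<dots> \<le> exp (- (real (card U) / q)) ^ J"
      using le assms(1) exp_ge_add_one_self[of "- (real (card U) / q)"] by (intro power_mono) auto
    also have "\<dots> = exp (- (real J * (real (card U) / q)))"
      by (simp add: exp_of_nat_mult[symmetric])
    also have "\<dots> \<le> exp (- s)"
      using J(1) cU assms(1) by (simp add: field_simps)
    finally show "real (card {x\<in>{0..<q}. \<forall>u\<in>U. (x + u) mod q \<notin> V}) / q \<le> exp (- s)" .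
  qed
qed

section \<open>Periodic unions of intervals of length 1/q\<close>

text \<open>For \<open>q > 0\<close> this is the 1-periodic union of the intervals
  \<open>[v / q, (v + 1) / q)\<close>. Moving \<open>x\<close> by \<open>u / q\<close> adds exactly
  \<open>u\<close> to the cell index, so a covering of residues becomes a covering of the torus
  without loss.\<close>

definition cells :: "int \<Rightarrow> int set \<Rightarrow> real set" where
  "cells q V = {x. \<lfloor>q * x\<rfloor> mod q \<in> V}"

lemma cells_periodic: "x + 1 \<in> cells q V \<longleftrightarrow> x \<in> cells q V"
proof -
  have "\<lfloor>q * (x + 1)\<rfloor> = \<lfloor>q * x\<rfloor> + q" by (simp add: distrib_left)
  then show ?thesis by (simp add: cells_def)
qed

lemma borel_cells [measurable]: "cells q V \<in> sets borel"
  unfolding cells_def by measurable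

lemma measure_cells_le:
  assumes "q > 0" "V \<subseteq> {0..<q}"
  shows "measure lebesgue (cells q V \<inter> {0..<1}) \<le> real (card V) / q"
proof -
  have fin: "finite V" using assms(2) finite_subset by blast
  have sub: "cells q V \<inter> {0..<1} \<subseteq> (\<Union>v\<in>V. {v / q..<(v + 1) / q})"
  proof
    fix x assume x: "x \<in> cells q V \<inter> {0..<1}"
    then have "0 \<le> \<lfloor>q * x\<rfloor>" "\<lfloor>q * x\<rfloor> < q"
      using assms(1) by (auto simp: floor_less_iff)
    then have "\<lfloor>q * x\<rfloor> \<in> V" using x by (simp add: cells_def)
    moreover have "x \<in> {\<lfloor>q * x\<rfloor> / q..<(\<lfloor>q * x\<rfloor> + 1) / q}"
      using assms(1) by (auto simp: field_simps) linarith+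
    ultimately show "x \<in> (\<Union>v\<in>V. {v / q..<(v + 1) / q})" by blast
  qed
  have *: "measure lebesgue {real_of_int v / q..<(v + 1) / q} = 1 / q" for v
    using assms(1) by (simp add: field_simps)
  have "measure lebesgue (cells q V \<inter> {0..<1}) \<le> measure lebesgue (\<Union>v\<in>V. {v / q..<(v + 1) / q})"
    using fin by (intro measure_mono_fmeasurable[OF sub]) (auto intro!: fmeasurable.finite_UN bounded_set_imp_lmeasurable)
  also have "\<dots> \<le> (\<Sum>v\<in>V. measure lebesgue {real_of_int v / q..<(v + 1) / q})"
    using fin by (intro measure_UNION_le) auto
  also have "\<dots> = real (card V) / q" by (simp add: *)
  finally show ?thesis .
qed

section \<open>Counting reduced fractions\<close>

lemma card_coprime_less:
  assumes "n > 0"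
  shows "card {a. a < n \<and> coprime a n} = totient n"
\<comment> \<open>For \<open>n = 1\<close> the two sets differ: the residue is 0 here, but 1 in
  \<open>totatives\<close>. Only the cardinalities agree.\<close>
proof (cases "n = 1")
  case True
  then have "{a. a < n \<and> coprime a n} = {0}" by auto
  with True show ?thesis by simp
next
  case False
  then have "{a. a < n \<and> coprime a n} = totatives n"
    using assms by (auto simp: totatives_def order.order_iff_strict intro: Nat.gr0I)
  then show ?thesis by (simp add: totient_def)
qed

text \<open>The integer \<open>a * (q div n)\<close> is the numerator of \<open>a / n\<close> over
  the common denominator \<open>q\<close>. A reduced fraction determines its numerator and
  denominator, so different pairs never collide.\<close>

lemma card_reduced_fractions:
  fixes q :: int
  assumes "finite N" "\<And>n. n \<in> N \<Longrightarrow> n > 0" "\<And>n. n \<in> N \<Longrightarrow> int n dvd q" "q > 0"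
  shows "card (\<Union>n\<in>N. (\<lambda>a. int a * (q div int n)) ` {a. a < n \<and> coprime a n}) = (\<Sum>n\<in>N. totient n)"
proof -
  define X where "X = (SIGMA n:N. {a. a < n \<and> coprime a n})"
  have eq: "(\<Union>n\<in>N. (\<lambda>a. int a * (q div int n)) ` {a. a < n \<and> coprime a n})
      = (\<lambda>(n, a). int a * (q div int n)) ` X"
    unfolding X_def by force
  have "inj_on (\<lambda>(n, a). int a * (q div int n)) X"
  proof (rule inj_onI, clarify)
    fix n a m b assume X: "(n, a) \<in> X" "(m, b) \<in> X" and e: "int a * (q div int n) = int b * (q div int m)"
    have nm: "n > 0" "m > 0" "int n * (q div int n) = q" "int m * (q div int m) = q"
      using X assms(2,3) unfolding X_def by auto
    have "int a * int m * q = int m * int n * (int a * (q div int n))"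
      using nm(3) by (metis mult.assoc mult.commute)
    also have "\<dots> = int m * int n * (int b * (q div int m))" by (simp only: e)
    also have "\<dots> = int b * int n * q"
      using nm(4) by (metis mult.assoc mult.commute)
    finally have "a * m = b * n"
      using assms(4) by (metis less_irrefl mult_right_cancel of_nat_eq_iff of_nat_mult)
    moreover have "coprime a n" "coprime b m" using X unfolding X_def by auto
    ultimately show "n = m \<and> a = b"
      using coprime_crossproduct_nat[of a n b m] by auto
  qed
  then have "card ((\<lambda>(n, a). int a * (q div int n)) ` X) = card X" by (rule card_image)
  also have "\<dots> = (\<Sum>n\<in>N. totient n)"
    unfolding X_def using assms(1,2) by (subst card_SigmaI) (auto simp: card_coprime_less)
  finally show ?thesis unfolding eq .
qed

text \<open>In Euler's product each prime factor contributes at least 1/2, and there are at most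
  \<open>card I\<close> of them (fewer if some exponents vanish). The loss is thus independent of
  the exponents.\<close>

lemma totient_prod_primes_ge:
  fixes p k :: "'a \<Rightarrow> nat"
  assumes "finite I" "\<And>i. i \<in> I \<Longrightarrow> prime (p i)"
  shows "real (totient (\<Prod>i\<in>I. p i ^ k i)) \<ge> real (\<Prod>i\<in>I. p i ^ k i) / 2 ^ card I"
proof -
  define m where "m = (\<Prod>i\<in>I. p i ^ k i)"
  have sub: "prime_factors m \<subseteq> p ` I"
  proof
    fix r assume "r \<in> prime_factors m"
    then have r: "prime r" "r dvd m" by auto
    then obtain i where i: "i \<in> I" "r dvd p i ^ k i"
      unfolding m_def using assms(1) by (auto simp: prime_dvd_prod_iff)
    then have "r dvd p i" using r(1) prime_dvd_power by blast
    then have "r = p i" using r(1) assms(2)[OF i(1)] by (simp add: primes_dvd_imp_eq)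
    then show "r \<in> p ` I" using i by blast
  qed
  have "card (prime_factors m) \<le> card I"
    using card_mono[OF _ sub] card_image_le[of I p] assms(1) by simp
  then have "(1 / 2 :: real) ^ card I \<le> (1 / 2) ^ card (prime_factors m)"
    by (intro power_decreasing) auto
  also have "\<dots> = (\<Prod>r\<in>prime_factors m. 1 / 2 :: real)" by simp
  also have "\<dots> \<le> (\<Prod>r\<in>prime_factors m. 1 - 1 / real r)"
  proof (rule prod_mono)
    fix r assume "r \<in> prime_factors m"
    then have "r \<ge> 2" using prime_ge_2_nat by auto
    then have "1 / real r \<le> 1 / 2" by (intro divide_left_mono) auto
    then show "0 \<le> (1 / 2 :: real) \<and> 1 / 2 \<le> 1 - 1 / real r" by simp
  qed
  finally have "real m * (1 / 2) ^ card I \<le> real m * (\<Prod>r\<in>prime_factors m. 1 - 1 / real r)"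
    by (intro mult_left_mono) auto
  then show ?thesis unfolding m_def[symmetric] totient_formula2 by (simp add: power_divide)
qed

section \<open>Many semigroup elements of comparable size\<close>

lemma multiplicity_prod_primes:
  fixes p k :: "'a \<Rightarrow> nat"
  assumes "finite I" "\<And>i. i \<in> I \<Longrightarrow> prime (p i)" "inj_on p I" "j \<in> I"
  shows "multiplicity (p j) (\<Prod>i\<in>I. p i ^ k i) = k j"
proof -
  have "(\<Prod>i\<in>I. p i ^ k i) = (\<Prod>r\<in>p ` I. r ^ k (the_inv_into I p r))"
    using assms(3) by (simp add: prod.reindex the_inv_into_f_f)
  also have "multiplicity (p j) \<dots> = k (the_inv_into I p (p j))"
    using assms by (subst multiplicity_prod_prime_powers) auto
  finally show ?thesis using assms(3,4) by (simp add: the_inv_into_f_f)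
qed

text \<open>The exponents of \<open>p 2, \<dots>, p d\<close> are free below \<open>L\<close>, and the exponent of \<open>p 1\<close> is then
  chosen to bring the product close to \<open>W ^ L\<close>.\<close>

lemma many_smooth_numbers:
  fixes p :: "nat \<Rightarrow> nat" and L :: nat
  assumes "d \<ge> 1" "\<And>i. i \<in> {1..d} \<Longrightarrow> prime (p i)" "inj_on p {1..d}"
  defines "W \<equiv> \<Prod>i=1..d. p i"
  obtains N where "finite N" "N \<subseteq> {\<Prod>i=1..d. p i ^ k i | k :: nat \<Rightarrow> nat. True}" "card N = L ^ (d - 1)"
    "\<And>n. n \<in> N \<Longrightarrow> n \<le> W ^ L" "\<And>n. n \<in> N \<Longrightarrow> W ^ L < p 1 * n"
proof -
  define K where "K = PiE {2..d} (\<lambda>_. {..<L})"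
  define m where "m k = (\<Prod>i=2..d. p i ^ k i)" for k :: "nat \<Rightarrow> nat"
  have split: "{1..d} = insert 1 {2..d}" using assms(1) by auto
  have p1: "p 1 \<ge> 2" and pos: "\<And>i. i \<in> {1..d} \<Longrightarrow> p i \<ge> 1"
    using assms(1,2) prime_ge_2_nat prime_ge_1_nat by auto
  have m_pos: "m k > 0" for k
    unfolding m_def using pos by (intro prod_pos) (force intro: Suc_le_lessD)
  have m_le: "m k \<le> W ^ L" if "k \<in> K" for k
  proof -
    have "m k \<le> (\<Prod>i=2..d. p i ^ L)"
      unfolding m_def
    proof (rule prod_mono)
      fix i assume i: "i \<in> {2..d}"
      then have "k i < L" using that unfolding K_def by (auto dest: PiE_mem)
      then show "0 \<le> p i ^ k i \<and> p i ^ k i \<le> p i ^ L"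
        using pos[of i] i by (auto intro!: power_increasing)
    qed
    also have "\<dots> \<le> p 1 ^ L * (\<Prod>i=2..d. p i ^ L)" using p1 by simp
    also have "\<dots> = W ^ L" unfolding W_def split by (simp add: prod_power_distrib power_mult_distrib)
    finally show ?thesis .
  qed
  \<comment> \<open>The exponent is the largest \<open>e\<close> with
    \<open>p 1 ^ e \<le> W ^ L div m k\<close>; it exists since \<open>m_le\<close> makes this
    quotient at least 1.\<close>
  have "\<exists>e. p 1 ^ e * m k \<le> W ^ L \<and> W ^ L < p 1 * (p 1 ^ e * m k)" if "k \<in> K" for k
  proof -
    have "W ^ L div m k \<ge> 1" using m_le[OF that] m_pos[of k] by (simp add: Suc_leI div_greater_zero_iff)
    then obtain e where "p 1 ^ e \<le> W ^ L div m k" "W ^ L div m k < p 1 ^ (e + 1)"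
      using ex_power_ivl1[OF p1] by blast
    then show ?thesis
      using m_pos[of k] by (intro exI[of _ e]) (auto simp: less_eq_div_iff_mult_less_eq div_less_iff_less_mult mult.assoc)
  qed
  then obtain e where e: "\<And>k. k \<in> K \<Longrightarrow> p 1 ^ e k * m k \<le> W ^ L"
    "\<And>k. k \<in> K \<Longrightarrow> W ^ L < p 1 * (p 1 ^ e k * m k)" by metis
  define f where "f k = p 1 ^ e k * m k" for k
  have f_eq: "f k = (\<Prod>i=1..d. p i ^ (k(1 := e k)) i)" for k
  proof -
    have "(\<Prod>i=2..d. p i ^ (k(1 := e k)) i) = m k"
      unfolding m_def by (intro prod.cong) auto
    then show ?thesis unfolding f_def split by simp
  qed
  \<comment> \<open>Unique factorization recovers the exponents of all primes other than
    \<open>p 1\<close>, whatever \<open>e k\<close> is.\<close>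
  have inj: "inj_on f K"
  proof (rule inj_onI)
    fix k k' assume kk: "k \<in> K" "k' \<in> K" "f k = f k'"
    have "k i = k' i" if "i \<in> {2..d}" for i
    proof -
      have "multiplicity (p i) (f k) = k i" for k
        unfolding f_eq using assms(2,3) that by (subst multiplicity_prod_primes) auto
      then show ?thesis using kk(3) by metis
    qed
    with kk show "k = k'" unfolding K_def by (blast intro: PiE_ext)
  qed
  show ?thesis
  proof
    show "finite (f ` K)" unfolding K_def by (intro finite_imageI finite_PiE) auto
    show "f ` K \<subseteq> {\<Prod>i=1..d. p i ^ k i | k :: nat \<Rightarrow> nat. True}" using f_eq by blast
    show "card (f ` K) = L ^ (d - 1)"
      using card_image[OF inj] by (simp add: K_def card_PiE)
  qed (use e f_def in auto)
qed

section \<open>Construction at a single scale\<close>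

text \<open>Along \<open>x = A * W ^ L\<close> the ratio \<open>ln x / L\<close> tends to
  \<open>ln W\<close>, so \<open>ln x\<close> may be traded for \<open>L\<close> at the price of a
  constant factor.\<close>

lemma phi_geometric_tendsto:
  fixes \<phi> :: "real \<Rightarrow> real"
  assumes lim: "((\<lambda>x. \<phi> x / (x * ln x ^ e)) \<longlongrightarrow> 0) at_top" and "W > 1" "A > 0"
  shows "(\<lambda>L. \<phi> (A * W ^ L) / (W ^ L * real L ^ e)) \<longlonglongrightarrow> 0"
proof -
  define x where "x L = A * W ^ L" for L :: nat
  have x: "filterlim x at_top sequentially"
    unfolding x_def using assms(2,3) by real_asymp
  have "(\<lambda>L. ln A / real L + ln W) \<longlonglongrightarrow> 0 + ln W"
    by (intro tendsto_add tendsto_const lim_const_over_n)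
  moreover have "eventually (\<lambda>L. ln A / real L + ln W = ln (x L) / real L) sequentially"
    using eventually_gt_at_top[of 0] by eventually_elim (use assms in \<open>simp add: x_def ln_mult ln_realpow field_simps\<close>)
  ultimately have "(\<lambda>L. ln (x L) / real L) \<longlonglongrightarrow> 0 + ln W"
    by (rule Lim_transform_eventually)
  then have "(\<lambda>L. \<phi> (x L) / (x L * ln (x L) ^ e) * (A * (ln (x L) / real L) ^ e)) \<longlonglongrightarrow> 0 * (A * (0 + ln W) ^ e)"
    by (intro tendsto_mult tendsto_power tendsto_const filterlim_compose[OF lim x])
  moreover have "eventually (\<lambda>L. \<phi> (x L) / (x L * ln (x L) ^ e) * (A * (ln (x L) / real L) ^ e)
      = \<phi> (A * W ^ L) / (W ^ L * real L ^ e)) sequentially"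
    using eventually_gt_at_top[of 0] filterlim_at_top_dense[THEN iffD1, OF x, rule_format, of 1]
  proof eventually_elim
    case (elim L)
    then have "ln (x L) > 0" by simp
    then show ?case using elim assms(2,3) by (simp add: x_def power_divide field_simps)
  qed
  ultimately have "(\<lambda>L. \<phi> (A * W ^ L) / (W ^ L * real L ^ e)) \<longlonglongrightarrow> 0 * (A * (0 + ln W) ^ e)"
    by (rule Lim_transform_eventually)
  then show ?thesis by simp
qed

text \<open>The function \<open>a * indicator F\<close> has a Riemann sum of size at least \<open>A\<close> at each point outside \<open>B\<close>.\<close>

definition spike :: "(real \<Rightarrow> real) \<Rightarrow> nat set \<Rightarrow> real \<Rightarrow> real \<Rightarrow> real \<Rightarrow> real set \<Rightarrow> real set \<Rightarrow> bool" where
  "spike \<phi> S A \<epsilon> a F B \<longleftrightarrow> a \<ge> 0 \<and> F \<in> sets borel \<and> B \<in> sets borel \<and> (\<forall>x. x + 1 \<in> F \<longleftrightarrow> x \<in> F)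
    \<and> (\<forall>x. x + 1 \<in> B \<longleftrightarrow> x \<in> B) \<and> measure lebesgue (F \<inter> {0..<1}) \<le> \<epsilon>
    \<and> \<phi> a * measure lebesgue (F \<inter> {0..<1}) \<le> \<epsilon> \<and> measure lebesgue (B \<inter> {0..<1}) \<le> \<epsilon>
    \<and> (\<forall>x. x \<notin> B \<longrightarrow> (\<exists>n\<in>S. \<exists>k<n. x + real k / real n \<in> F \<and> A * real n \<le> a))"

text \<open>The constants \<open>s\<close> and \<open>C\<close> depend only on
  \<open>\<epsilon>\<close> and the primes. They are fixed before \<open>L\<close>, so a large
  \<open>L\<close> makes the limits beat them.\<close>

lemma single_scale:
  fixes p :: "nat \<Rightarrow> nat" and \<phi> :: "real \<Rightarrow> real"
  assumes "d \<ge> 1" "\<And>i. i \<in> {1..d} \<Longrightarrow> prime (p i)" "inj_on p {1..d}"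
    and nonneg: "\<And>x. x \<ge> 0 \<Longrightarrow> \<phi> x \<ge> 0"
    and lim: "((\<lambda>x. \<phi> x / (x * ln x ^ (d - 1))) \<longlongrightarrow> 0) at_top"
    and "A > 0" "\<epsilon> > 0"
  defines "S \<equiv> {\<Prod>i=1..d. p i ^ k i | k :: nat \<Rightarrow> nat. True}"
  shows "\<exists>a F B. spike \<phi> S A \<epsilon> a F B"
proof -
  define W where "W = (\<Prod>i=1..d. p i)"
  \<comment> \<open>The maximum keeps \<open>s\<close> nonnegative when
    \<open>\<epsilon> > 1\<close>.\<close>
  define s where "s = max 0 (- ln \<epsilon>)"
  have s: "s \<ge> 0" "exp (- s) \<le> \<epsilon>"
  proof -
    have "exp (- s) \<le> exp (ln \<epsilon>)" unfolding s_def by (subst exp_le_cancel_iff) auto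
    then show "exp (- s) \<le> \<epsilon>" using assms(7) by simp
  qed (simp add: s_def)
  have p1: "p 1 \<ge> 2" using assms(1,2) prime_ge_2_nat by auto
  have split: "{1..d} = insert 1 {2..d}" using assms(1) by auto
  have "(\<Prod>i=2..d. p i) \<ge> 1"
    using assms(2) prime_ge_1_nat by (intro prod_ge_1) auto
  with p1 have "2 * 1 \<le> p 1 * (\<Prod>i=2..d. p i)" by (rule mult_le_mono)
  also have "\<dots> = W" unfolding W_def split by simp
  finally have "W \<ge> 2" by simp
  then have W: "real W > 1" by simp
  \<comment> \<open>Chosen so that the covering bound \<open>(s + 1) / c\<close>, with
    \<open>c\<close> as defined below, equals \<open>C / (W ^ L * L ^ (d - 1))\<close>.\<close>
  define C where "C = (s + 1) * 2 ^ d * real (p 1)"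
  have C: "C \<ge> 0" unfolding C_def using s by simp
  have l1: "(\<lambda>L. C * (\<phi> (A * real W ^ L) / (real W ^ L * real L ^ (d - 1)))) \<longlonglongrightarrow> C * 0"
    by (intro tendsto_mult tendsto_const phi_geometric_tendsto lim W assms)
  \<comment> \<open>The same limit for the constant function 1 in place of \<open>\<phi>\<close>
    serves to bound the measure of \<open>F\<close> itself: \<open>\<phi> a\<close> may be small or
    zero, so the bound on the product does not give it.\<close>
  have "((\<lambda>x::real. 1 / (x * ln x ^ (d - 1))) \<longlongrightarrow> 0) at_top"
  proof -
    have "((\<lambda>x::real. 1 / x * (1 / ln x) ^ (d - 1)) \<longlongrightarrow> 0 * 0 ^ (d - 1)) at_top"
      by (intro tendsto_mult tendsto_power; real_asymp)
    then show ?thesis by (simp add: power_divide)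
  qed
  then have l2: "(\<lambda>L. C * (1 / (real W ^ L * real L ^ (d - 1)))) \<longlonglongrightarrow> C * 0"
    by (intro tendsto_mult tendsto_const phi_geometric_tendsto[where \<phi> = "\<lambda>_. 1" and A = 1] W zero_less_one)
  have "eventually (\<lambda>L. C * (\<phi> (A * real W ^ L) / (real W ^ L * real L ^ (d - 1))) < \<epsilon>
      \<and> C * (1 / (real W ^ L * real L ^ (d - 1))) < \<epsilon> \<and> L > 0) sequentially"
    using l1 l2 assms(7) by (intro eventually_conj eventually_gt_at_top) (auto elim: order_tendstoD)
  then obtain L where L: "C * (\<phi> (A * real W ^ L) / (real W ^ L * real L ^ (d - 1))) < \<epsilon>"
      "C * (1 / (real W ^ L * real L ^ (d - 1))) < \<epsilon>" "L > 0"
    unfolding eventually_sequentially by blast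
  obtain N where N: "finite N" "N \<subseteq> S" "card N = L ^ (d - 1)"
    "\<And>n. n \<in> N \<Longrightarrow> n \<le> W ^ L" "\<And>n. n \<in> N \<Longrightarrow> W ^ L < p 1 * n"
    using many_smooth_numbers[OF assms(1-3), of L] unfolding W_def S_def by blast
  have N_pos: "n > 0" if "n \<in> N" for n using N(5)[OF that] by (cases n) auto
  define q where "q = int (\<Prod>N)"
  have q: "q > 0" unfolding q_def using N_pos by (auto intro!: prod_pos)
  have dvd: "int n dvd q" if "n \<in> N" for n
    unfolding q_def using dvd_prodI[OF N(1) that, of "\<lambda>n. n"] by (simp only: int_dvd_int_iff)
  define U where "U = (\<Union>n\<in>N. (\<lambda>a. int a * (q div int n)) ` {a. a < n \<and> coprime a n})"
  have U_sub: "U \<subseteq> {0..<q}"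
  proof
    fix u assume "u \<in> U"
    then obtain n a where na: "n \<in> N" "a < n" "u = int a * (q div int n)" unfolding U_def by auto
    have "int n * (q div int n) = q" using dvd[OF na(1)] by simp
    moreover have "q div int n > 0" using dvd[OF na(1)] q N_pos[OF na(1)]
      by (simp add: pos_imp_zdiv_pos_iff zdvd_imp_le)
    ultimately have "u < q" "u \<ge> 0" unfolding na(3) using na(2)
      by (metis mult_strict_right_mono of_nat_less_iff) (simp add: \<open>q div int n > 0\<close> less_imp_le)
    then show "u \<in> {0..<q}" by simp
  qed
  \<comment> \<open>There are \<open>L ^ (d - 1)\<close> denominators \<open>n\<close>, each
    contributing \<open>totient n \<ge> n / 2 ^ d\<close> fractions, and
    \<open>n > W ^ L / p 1\<close>.\<close>
  define c where "c = real W ^ L * real L ^ (d - 1) / (2 ^ d * real (p 1))"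
  have c_pos: "c > 0" unfolding c_def using W L(3) p1 by (auto intro!: divide_pos_pos mult_pos_pos)
  have cardU: "c \<le> real (card U)"
  proof -
    have "real (totient n) \<ge> real W ^ L / (2 ^ d * real (p 1))" if n: "n \<in> N" for n
    proof -
      obtain k where "n = (\<Prod>i=1..d. p i ^ k i)" using n N(2) unfolding S_def by blast
      then have "real (totient n) \<ge> real n / 2 ^ d"
        using totient_prod_primes_ge[of "{1..d}" p k] assms(2) by simp
      moreover have "real W ^ L / real (p 1) \<le> real n"
        using N(5)[OF that] p1 by (simp add: field_simps flip: of_nat_power of_nat_mult)
      then have "real W ^ L / real (p 1) / 2 ^ d \<le> real n / 2 ^ d" by (intro divide_right_mono) auto
      moreover have "real W ^ L / real (p 1) / 2 ^ d = real W ^ L / (2 ^ d * real (p 1))" by simp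
      ultimately show ?thesis by linarith
    qed
    then have "real (card N) * (real W ^ L / (2 ^ d * real (p 1))) \<le> (\<Sum>n\<in>N. real (totient n))"
      by (intro sum_bounded_below) auto
    also have "\<dots> = real (card U)"
      unfolding U_def using card_reduced_fractions[OF N(1) N_pos dvd q] by simp
    finally show ?thesis by (simp add: c_def N(3) mult.commute)
  qed
  then have "U \<noteq> {}" using c_pos by auto
  then obtain V where V: "V \<subseteq> {0..<q}" "real (card V) / q \<le> (s + 1) / card U"
    "real (card {x\<in>{0..<q}. \<forall>u\<in>U. (x + u) mod q \<notin> V}) / q \<le> exp (- s)"
    using efficient_cover[OF q U_sub _ s(1)] by blast
  define D where "D = {x\<in>{0..<q}. \<forall>u\<in>U. (x + u) mod q \<notin> V}"
  define a where "a = A * real W ^ L"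
  have a: "a \<ge> 0" unfolding a_def using assms(6) by simp
  have "measure lebesgue (cells q V \<inter> {0..<1}) \<le> (s + 1) / card U"
    using measure_cells_le[OF q V(1)] V(2) by linarith
  also have "\<dots> \<le> (s + 1) / c"
    using cardU c_pos s(1) by (intro divide_left_mono) auto
  also have "\<dots> = C * (1 / (real W ^ L * real L ^ (d - 1)))"
    unfolding c_def C_def by simp
  finally have mV: "measure lebesgue (cells q V \<inter> {0..<1}) \<le> C * (1 / (real W ^ L * real L ^ (d - 1)))" .
  then have "\<phi> a * measure lebesgue (cells q V \<inter> {0..<1}) \<le> \<phi> a * (C * (1 / (real W ^ L * real L ^ (d - 1))))"
    using nonneg[OF a] by (rule mult_left_mono)
  also have "\<dots> \<le> \<epsilon>" using L(1) unfolding a_def by (simp add: mult.commute)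
  finally have m\<phi>: "\<phi> a * measure lebesgue (cells q V \<inter> {0..<1}) \<le> \<epsilon>" .
  have "measure lebesgue (cells q D \<inter> {0..<1}) \<le> \<epsilon>"
    using measure_cells_le[OF q, of D] V(3) s(2) unfolding D_def by force
  moreover have "\<exists>n\<in>S. \<exists>k<n. x + real k / real n \<in> cells q V \<and> A * real n \<le> a" if x: "x \<notin> cells q D" for x
  proof -
    have "\<lfloor>q * x\<rfloor> mod q \<in> {0..<q}" using q by simp
    then obtain u where u: "u \<in> U" "(\<lfloor>q * x\<rfloor> mod q + u) mod q \<in> V"
      using x unfolding cells_def D_def by blast
    then obtain n k where nk: "n \<in> N" "k < n" "u = int k * (q div int n)" unfolding U_def by auto
    \<comment> \<open>Since \<open>u / q = k / n\<close>, the shift by \<open>k / n\<close> moves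
      the cell index by exactly \<open>u\<close>.\<close>
    have "real_of_int q = real n * real_of_int (q div int n)"
      using dvd[OF nk(1)] by (metis dvd_mult_div_cancel of_int_mult of_int_of_nat_eq)
    then have "q * (x + real k / real n) = q * x + real_of_int u"
      unfolding nk(3) using N_pos[OF nk(1)] by (simp add: field_simps)
    then have "\<lfloor>q * (x + real k / real n)\<rfloor> = \<lfloor>q * x\<rfloor> + u" by simp
    then have "x + real k / real n \<in> cells q V"
      using u(2) by (simp add: cells_def mod_add_left_eq)
    moreover have "A * real n \<le> a"
      unfolding a_def using N(4)[OF nk(1)] assms(6) by (simp flip: of_nat_power)
    ultimately show ?thesis using nk N(2) by blast
  qed
  ultimately show ?thesis
    unfolding spike_def using a mV L(2) m\<phi> by (intro exI[of _ a] exI[of _ "cells q V"] exI[of _ "cells q D"])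
      (auto simp: cells_periodic)
qed

section \<open>Denominators of rationals\<close>

text \<open>For rational \<open>y\<close> this is the denominator in lowest terms; described as a
  least multiplier, it is visibly invariant under integer shifts.\<close>

definition min_denom :: "real \<Rightarrow> nat" where
  "min_denom y = (LEAST b. b > 0 \<and> real b * y \<in> \<int>)"

lemma min_denom:
  assumes "y \<in> \<rat>"
  shows "min_denom y > 0" "real (min_denom y) * y \<in> \<int>"
proof -
  obtain a b where "b > 0" "y = real_of_int a / real_of_int b"
    using assms by (metis Rats_cases')
  then have "nat b > 0 \<and> real (nat b) * y \<in> \<int>" by simp
  then have "min_denom y > 0 \<and> real (min_denom y) * y \<in> \<int>"
    unfolding min_denom_def by (rule LeastI)
  then show "min_denom y > 0" "real (min_denom y) * y \<in> \<int>" by auto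
qed

lemma min_denom_add_1: "min_denom (y + 1) = min_denom y"
proof -
  have "real b * (y + 1) \<in> \<int> \<longleftrightarrow> real b * y \<in> \<int>" for b
    by (simp add: distrib_left)
  then show ?thesis by (simp add: min_denom_def)
qed

text \<open>The product of the two denominators clears both \<open>y\<close> and
  \<open>y + 1 / n\<close>, hence also their difference \<open>1 / n\<close>. For fixed
  \<open>y\<close> the denominator of \<open>y + 1 / n\<close> therefore grows at least linearly in
  \<open>n\<close>.\<close>

lemma le_min_denom_mult:
  assumes "y \<in> \<rat>" "n > 0"
  shows "n \<le> min_denom y * min_denom (y + 1 / real n)"
proof -
  define b where "b = min_denom y"
  define D where "D = min_denom (y + 1 / real n)"
  have "y + 1 / real n \<in> \<rat>" using assms(1) by (intro Rats_add Rats_divide) auto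
  from min_denom[OF this] min_denom[OF assms(1)]
  have D: "D > 0" "real D * (y + 1 / real n) \<in> \<int>" and b: "b > 0" "real b * y \<in> \<int>"
    unfolding D_def b_def by auto
  have "real b * (real D * (y + 1 / real n)) - real D * (real b * y) \<in> \<int>"
    by (intro Ints_diff Ints_mult[OF Ints_of_nat] D(2) b(2))
  also have "real b * (real D * (y + 1 / real n)) - real D * (real b * y) = real (b * D) / real n"
    by (simp add: field_simps)
  finally obtain z where z: "real (b * D) / real n = of_int z" by (rule Ints_cases)
  have "real (b * D) / real n > 0" using D(1) b(1) assms(2) by simp
  then have "real (b * D) / real n \<ge> 1" using z by simp
  then show ?thesis using assms(2) unfolding b_def[symmetric] D_def[symmetric]
    by (simp add: field_simps flip: of_nat_mult)
qed

section \<open>Superposition of all scales\<close>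

lemma riemann_sum_ge_term:
  assumes "\<And>y. f y \<ge> 0" "k < n"
  shows "riemann_sum n f x \<ge> f (x + real k / real n) / real n"
proof -
  have "f (x + real k / real n) \<le> (\<Sum>k<n. f (x + real k / real n))"
    using assms by (intro member_le_sum) auto
  then show ?thesis unfolding riemann_sum_def by (simp add: divide_right_mono)
qed

text \<open>Only finitely many values occur, so the supremum is attained. Taking it in the extended
  reals makes it measurable in \<open>x\<close> even where infinitely many \<open>F j\<close>
  meet.\<close>

lemma real_SUP_indicator:
  fixes a :: "nat \<Rightarrow> real"
  assumes fin: "finite {j. x \<in> F j}" and nonneg: "\<And>j. a j \<ge> 0"
  defines "g \<equiv> real_of_ereal (SUP j. ereal (a j * indicator (F j) x))"
  shows "\<And>j. x \<in> F j \<Longrightarrow> a j \<le> g" "g = 0 \<or> (\<exists>j. x \<in> F j \<and> g = a j)"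
proof -
  define X where "X = range (\<lambda>j. ereal (a j * indicator (F j) x))"
  have sub: "X \<subseteq> insert 0 ((\<lambda>j. ereal (a j)) ` {j. x \<in> F j})"
    unfolding X_def by (auto simp: indicator_def zero_ereal_def)
  then have finX: "finite X" using fin finite_subset by blast
  moreover have "X \<noteq> {}" unfolding X_def by simp
  ultimately have "Sup X \<in> X" using Max_in Max_Sup by metis
  then obtain i where i: "Sup X = ereal (a i * indicator (F i) x)" unfolding X_def by blast
  then have g: "g = a i * indicator (F i) x" unfolding g_def X_def by simp
  then show "g = 0 \<or> (\<exists>j. x \<in> F j \<and> g = a j)" by (auto simp: indicator_def)
  fix j assume "x \<in> F j"
  then have "ereal (a j) \<in> X" unfolding X_def by (intro image_eqI[of _ _ j]) auto
  then have "ereal (a j) \<le> Sup X" by (rule Sup_upper)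
  then show "a j \<le> g" unfolding i g by simp
qed

lemma everywhere_unbounded_riemann_sums:
  fixes \<phi> :: "real \<Rightarrow> real" and S :: "nat set"
  assumes S: "infinite S"
    and mono: "mono_on {0..} \<phi>" and nonneg: "\<And>x. x \<ge> 0 \<Longrightarrow> \<phi> x \<ge> 0"
    and scale: "\<And>A \<epsilon>. A > 0 \<Longrightarrow> \<epsilon> > 0 \<Longrightarrow> \<exists>a F B. spike \<phi> S A \<epsilon> a F B"
  shows "\<exists>f \<in> L_class \<phi>. \<forall>x C. \<exists>n\<in>S. riemann_sum n f x > C"
proof -
  have "\<exists>a F B. spike \<phi> S (real (Suc j)) ((1/2)^j) a F B" for j
    by (rule scale) auto
  then obtain a F B where spike: "\<And>j. spike \<phi> S (real (Suc j)) ((1/2)^j) (a j) (F j) (B j)"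
    by metis
  have a: "a j \<ge> 0" and F_meas [measurable]: "F j \<in> sets borel" and B_meas [measurable]: "B j \<in> sets borel" for j
    using spike[of j] unfolding spike_def by blast+
  have per: "x + 1 \<in> F j \<longleftrightarrow> x \<in> F j" "x + 1 \<in> B j \<longleftrightarrow> x \<in> B j" for j x
    using spike[of j] unfolding spike_def by blast+
  have small: "measure lebesgue (F j \<inter> {0..<1}) \<le> (1/2)^j"
      "\<phi> (a j) * measure lebesgue (F j \<inter> {0..<1}) \<le> (1/2)^j"
      "measure lebesgue (B j \<inter> {0..<1}) \<le> (1/2)^j" for j
    using spike[of j] unfolding spike_def by blast+
  have cover: "\<exists>n\<in>S. \<exists>k<n. x + real k / real n \<in> F j \<and> real (Suc j) * real n \<le> a j" if "x \<notin> B j" for j x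
    using spike[of j] that unfolding spike_def by blast
  \<comment> \<open>Borel-Cantelli is needed for both sets: for \<open>F j\<close> to make the
    supremum finite, for \<open>B j\<close> to have a large Riemann sum at every late scale.\<close>
  define G where "G j = F j \<union> B j" for j
  have G_meas: "G j \<in> sets borel" for j unfolding G_def by auto
  have Glm: "X \<inter> {0..<1} \<in> lmeasurable" if "X \<in> sets borel" for X :: "real set"
  proof (rule bounded_set_imp_lmeasurable)
    show "bounded (X \<inter> {0..<1})" by (rule bounded_subset[of "{0..1}"]) auto
    show "X \<inter> {0..<1} \<in> sets lebesgue" using that by auto
  qed
  have Gm: "measure lebesgue (G j \<inter> {0..<1}) \<le> 2 * (1/2)^j" for j
  proof -
    have "measure lebesgue ((F j \<inter> {0..<1}) \<union> (B j \<inter> {0..<1}))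
      \<le> measure lebesgue (F j \<inter> {0..<1}) + measure lebesgue (B j \<inter> {0..<1})"
      by (intro measure_Un_le fmeasurableD[OF Glm] F_meas B_meas)
    moreover have "(F j \<inter> {0..<1}) \<union> (B j \<inter> {0..<1}) = G j \<inter> {0..<1}" unfolding G_def by auto
    ultimately show ?thesis using small(1,3)[of j] by simp
  qed
  define N where "N = {x\<in>{0..<1}. \<not> (\<forall>\<^sub>F j in sequentially. x \<notin> G j)}"
  have "AE x in lebesgue. \<forall>\<^sub>F j in sequentially. x \<in> space lebesgue - (G j \<inter> {0..<1})"
  proof (rule borel_cantelli_AE1)
    show "G j \<inter> {0..<1} \<in> sets lebesgue" for j by (intro fmeasurableD[OF Glm] G_meas)
    show "emeasure lebesgue (G j \<inter> {0..<1}) < \<infinity>" for j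
      using Glm[OF G_meas, of j] unfolding fmeasurable_def by auto
    show "summable (\<lambda>j. measure lebesgue (G j \<inter> {0..<1}))"
      by (rule summable_comparison_test'[where g = "\<lambda>j. 2 * (1/2)^j"])
        (use Gm in \<open>auto intro!: summable_mult summable_geometric\<close>)
  qed
  then have "AE x in lebesgue. x \<notin> N"
    by eventually_elim (auto simp: N_def frequently_def elim: eventually_mono)
  then have negN: "negligible N"
    by (simp add: negligible_iff_null_sets AE_iff_null_sets completion.AE_iff_null_sets)
  \<comment> \<open>Invariance under rational shifts puts all sample points \<open>x + k / n\<close>
    in \<open>Z\<close> or all outside, according to \<open>x\<close>.\<close>
  define Z where "Z = {x. \<exists>r\<in>\<rat>. x + r \<in> N}"
  have Z_eq: "Z = (\<Union>r\<in>\<rat>. (+) (- r) ` N)"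
    unfolding Z_def by (auto simp: image_iff) (metis add.commute add_diff_cancel_left' uminus_add_conv_diff)+
  have negZ: "negligible Z"
    unfolding Z_eq
    by (rule negligible_countable_Union) (use negligible_translation[OF negN] countable_rat in blast)+
  have Z_shift: "x + r \<in> Z \<longleftrightarrow> x \<in> Z" if "r \<in> \<rat>" for x r
  proof
    assume "x + r \<in> Z"
    then obtain s where "s \<in> \<rat>" "x + (r + s) \<in> N" unfolding Z_def by (auto simp: add.assoc)
    then show "x \<in> Z" unfolding Z_def using that by (auto intro!: bexI[of _ "r + s"])
  next
    assume "x \<in> Z"
    then obtain s where "s \<in> \<rat>" "x + s \<in> N" unfolding Z_def by auto
    then show "x + r \<in> Z" unfolding Z_def using that by (auto intro!: bexI[of _ "s - r"])
  qed
  have per_int: "x + of_int z \<in> X \<longleftrightarrow> x \<in> X" if "\<And>x. x + 1 \<in> X \<longleftrightarrow> x \<in> X" for X :: "real set" and x z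
  proof (induction z rule: int_induct[where k = 0])
    case (step1 i)
    then show ?case using that[of "x + of_int i"] by (simp add: add.assoc)
  next
    case (step2 i)
    then show ?case using that[of "x + of_int (i - 1)"] by (simp add: add.assoc)
  qed simp
  have ev: "\<forall>\<^sub>F j in sequentially. x \<notin> G j" if "x \<notin> Z" for x
  proof -
    have "frac x = x + of_int (- \<lfloor>x\<rfloor>)" by (simp add: frac_def)
    moreover have "frac x \<notin> N"
      using that unfolding Z_def calculation by (metis (mono_tags, lifting) Rats_of_int mem_Collect_eq)
    moreover have "frac x \<in> {0..<1}" by (simp add: frac_lt_1)
    ultimately have "\<forall>\<^sub>F j in sequentially. x + of_int (- \<lfloor>x\<rfloor>) \<notin> G j" unfolding N_def by auto
    then show ?thesis
      by (rule eventually_mono) (metis G_def Un_iff per per_int)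
  qed
  have finF: "finite {j. x \<in> F j}" if x: "x \<notin> Z" for x
  proof -
    obtain m where "\<And>j. j \<ge> m \<Longrightarrow> x \<notin> G j" using ev[OF x] unfolding eventually_sequentially by blast
    then have "{j. x \<in> F j} \<subseteq> {..<m}" unfolding G_def by (auto simp: not_le[symmetric])
    then show ?thesis using finite_subset by blast
  qed
  define g where "g x = real_of_ereal (SUP j. ereal (a j * indicator (F j) x))" for x
  have g_meas [measurable]: "g \<in> borel_measurable borel" unfolding g_def by measurable
  have g_ge: "a j \<le> g x" if "x \<notin> Z" "x \<in> F j" for x j
    unfolding g_def using real_SUP_indicator(1)[of x F a, OF finF a] that by blast
  have g_cases: "g x = 0 \<or> (\<exists>j. x \<in> F j \<and> g x = a j)" if "x \<notin> Z" for x
    unfolding g_def using real_SUP_indicator(2)[of x F a, OF finF a] that by blast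
  have g_per: "g (x + 1) = g x" for x unfolding g_def using per by (simp add: indicator_def)
  define rep where "rep x = (SOME y::real. x - y \<in> \<rat>)" for x
  have rep: "x - rep x \<in> \<rat>" for x unfolding rep_def by (rule someI[of _ x]) simp
  have rep_shift: "rep (x + r) = rep x" if "r \<in> \<rat>" for x r
  proof -
    have "x + r - y \<in> \<rat> \<longleftrightarrow> x - y \<in> \<rat>" for y
      using Rats_add[of "x - y" r] Rats_diff[of "x + r - y" r] that by (auto simp: algebra_simps)
    then show ?thesis unfolding rep_def by simp
  qed
  \<comment> \<open>The square is what outgrows the factor \<open>1 / n\<close> of the Riemann
    sum.\<close>
  define f where "f x = (if x \<in> Z then (real (min_denom (x - rep x)))\<^sup>2 else g x)" for x
  have f_nonneg: "f x \<ge> 0" for x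
    unfolding f_def using g_cases[of x] a by auto
  have "f (x + 1) = f x" for x
    using Z_shift[of 1 x] rep_shift[of 1 x] min_denom_add_1[of "x - rep x"] g_per[of x]
    by (simp add: f_def algebra_simps)
  moreover have f_meas: "f \<in> borel_measurable lebesgue"
  proof (rule measurableI)
    fix A :: "real set" assume A: "A \<in> sets borel"
    \<comment> \<open>The choice of \<open>rep\<close> may be non-measurable, but it affects
      \<open>f\<close> only on a null set, all of whose subsets are Lebesgue measurable.\<close>
    have "f -` A = (g -` A - Z) \<union> (f -` A \<inter> Z)" unfolding f_def by auto
    moreover have "g -` A \<in> sets borel" using measurable_sets[OF g_meas A] by simp
    then have "g -` A \<in> sets lebesgue" by auto
    moreover have "Z \<in> sets lebesgue" using negZ by (rule negligible_imp_sets)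
    moreover have "negligible (f -` A \<inter> Z)" using negZ negligible_subset by blast
    then have "f -` A \<inter> Z \<in> sets lebesgue" by (rule negligible_imp_sets)
    ultimately have "f -` A \<in> sets lebesgue" by (metis sets.Diff sets.Un)
    then show "f -` A \<inter> space lebesgue \<in> sets lebesgue" by simp
  qed simp
  then have f_torus: "f \<in> borel_measurable torus" by (rule measurable_restrict_space1)
  moreover have "integrable torus (\<lambda>x. \<phi> \<bar>f x\<bar>)"
  proof (rule integrableI_nonneg)
    have "mono (\<lambda>y. \<phi> (max 0 y))"
      by (rule monoI) (auto intro!: mono_onD[OF mono])
    then have "(\<lambda>y. \<phi> (max 0 y)) \<in> borel_measurable borel" by (rule borel_measurable_mono)
    from measurable_compose[OF f_torus this]
    show "(\<lambda>x. \<phi> \<bar>f x\<bar>) \<in> borel_measurable torus"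
      using f_nonneg by (simp add: max_def)
    show "AE x in torus. 0 \<le> \<phi> \<bar>f x\<bar>" using nonneg by simp
    define I where "I j = F j \<inter> {0..<1}" for j
    have Is: "I j \<in> sets torus" for j
      unfolding I_def by (auto simp: sets_restrict_space)
    have eI: "emeasure torus (I j) = ennreal (measure lebesgue (I j))" for j
    proof -
      have "emeasure torus (I j) = emeasure lebesgue (I j)"
        by (rule emeasure_restrict_space) (auto simp: I_def)
      then show ?thesis using Glm[of "F j"] by (simp add: I_def emeasure_eq_measure2)
    qed
    have "AE x in lebesgue. x \<notin> Z"
      using negZ unfolding negligible_iff_null_sets by (rule AE_not_in)
    then have "AE x in torus. x \<notin> Z"
      by (subst AE_restrict_space_iff) (auto elim: eventually_mono)
    \<comment> \<open>Almost everywhere \<open>f x\<close> is 0 or a single \<open>a j\<close> with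
      \<open>x\<close> in \<open>F j\<close>; the term \<open>\<phi> 0\<close> covers the first
      case.\<close>
    then have "AE x in torus. ennreal (\<phi> \<bar>f x\<bar>) \<le> ennreal (\<phi> 0) + (\<Sum>j. ennreal (\<phi> (a j)) * indicator (I j) x)"
      using AE_space
    proof eventually_elim
      case (elim x)
      then have f: "f x = g x" and x: "x \<in> {0..<1}" by (auto simp: f_def)
      from g_cases[OF elim(1)] show ?case
      proof
        assume "\<exists>j. x \<in> F j \<and> g x = a j"
        then obtain j where j: "x \<in> F j" "g x = a j" by blast
        have "ennreal (\<phi> \<bar>f x\<bar>) = (\<Sum>i\<in>{j}. ennreal (\<phi> (a i)) * indicator (I i) x)"
          using j a[of j] x by (simp add: f I_def)
        also have "\<dots> \<le> (\<Sum>j. ennreal (\<phi> (a j)) * indicator (I j) x)"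
          by (intro sum_le_suminf) auto
        also have "\<dots> \<le> ennreal (\<phi> 0) + \<dots>" by simp
        finally show ?thesis .
      qed (simp add: f)
    qed
    then have "(\<integral>\<^sup>+x. ennreal (\<phi> \<bar>f x\<bar>) \<partial>torus)
        \<le> (\<integral>\<^sup>+x. (ennreal (\<phi> 0) + (\<Sum>j. ennreal (\<phi> (a j)) * indicator (I j) x)) \<partial>torus)"
      by (rule nn_integral_mono_AE)
    also have "\<dots> = ennreal (\<phi> 0) * emeasure torus (space torus) + (\<Sum>j. ennreal (\<phi> (a j)) * emeasure torus (I j))"
      using Is by (subst nn_integral_add) (auto simp: nn_integral_suminf nn_integral_cmult_indicator)
    also have "(\<Sum>j. ennreal (\<phi> (a j)) * emeasure torus (I j)) \<le> (\<Sum>j. ennreal ((1/2)^j))"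
    proof (rule suminf_le)
      fix j
      have "ennreal (\<phi> (a j)) * emeasure torus (I j) = ennreal (\<phi> (a j) * measure lebesgue (I j))"
        unfolding eI using nonneg[OF a] by (rule ennreal_mult[symmetric]) simp
      also have "\<dots> \<le> ennreal ((1/2)^j)" using small(2)[of j] unfolding I_def by (rule ennreal_leI)
      finally show "ennreal (\<phi> (a j)) * emeasure torus (I j) \<le> ennreal ((1/2)^j)" .
    qed auto
    also have "\<dots> = ennreal (\<Sum>j. (1/2)^j)"
      by (intro suminf_ennreal2 summable_geometric) auto
    also have "ennreal (\<phi> 0) * emeasure torus (space torus) = ennreal (\<phi> 0)"
      by (simp add: emeasure_restrict_space)
    finally show "(\<integral>\<^sup>+x. ennreal (\<phi> \<bar>f x\<bar>) \<partial>torus) < \<infinity>"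
      by (rule le_less_trans) auto
  qed
  ultimately have "f \<in> L_class \<phi>" unfolding L_class_def by blast
  moreover have "\<exists>n\<in>S. riemann_sum n f x > C" for x C
  proof (cases "x \<in> Z")
    case True
    define b where "b = min_denom (x - rep x)"
    have b: "b > 0" unfolding b_def using min_denom(1)[OF rep] .
    \<comment> \<open>\<open>n > 1\<close> makes \<open>k = 1\<close> an admissible index, and
      \<open>n > C * b\<^sup>2\<close> suffices because \<open>D \<ge> n / b\<close> gives
      \<open>D\<^sup>2 / n \<ge> n / b\<^sup>2\<close>.\<close>
    obtain n where n: "n \<in> S" "n > max 1 (nat \<lceil>C * (real b)\<^sup>2\<rceil>)"
      using S unfolding infinite_nat_iff_unbounded by blast
    define D where "D = min_denom (x - rep x + 1 / real n)"
    have "n \<le> b * D" unfolding b_def D_def using n by (intro le_min_denom_mult rep) auto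
    then have "(real n)\<^sup>2 \<le> (real b * real D)\<^sup>2" by (intro power_mono) (simp_all flip: of_nat_mult)
    then have "(real n)\<^sup>2 / (real b)\<^sup>2 \<le> (real D)\<^sup>2" using b by (simp add: field_simps power_mult_distrib)
    have r: "1 / real n \<in> \<rat>" by (intro Rats_divide) auto
    have "f (x + real 1 / real n) = (real D)\<^sup>2"
      using Z_shift[OF r, of x] rep_shift[OF r, of x] True by (simp add: f_def D_def algebra_simps)
    then have "riemann_sum n f x \<ge> (real D)\<^sup>2 / real n"
      using riemann_sum_ge_term[of f 1 n x] f_nonneg n(2) by auto
    moreover have "C * (real b)\<^sup>2 < real n" using n(2) by linarith
    then have "C < real n / (real b)\<^sup>2" using b by (simp add: field_simps)
    moreover have "real n / (real b)\<^sup>2 = (real n)\<^sup>2 / (real b)\<^sup>2 / real n" using n(2) by (simp add: power2_eq_square)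
    moreover have "\<dots> \<le> (real D)\<^sup>2 / real n"
      using \<open>(real n)\<^sup>2 / (real b)\<^sup>2 \<le> (real D)\<^sup>2\<close> by (rule divide_right_mono) simp
    ultimately show ?thesis using n(1) by (intro bexI[of _ n]) linarith+
  next
    case False
    obtain m where m: "\<And>j. j \<ge> m \<Longrightarrow> x \<notin> G j" using ev[OF False] unfolding eventually_sequentially by blast
    \<comment> \<open>Late enough that \<open>x\<close> avoids \<open>B j\<close>, and large enough
      that \<open>j + 1 > C\<close>.\<close>
    define j where "j = max m (nat \<lceil>C\<rceil>)"
    have "x \<notin> B j" using m[of j] unfolding j_def G_def by auto
    then obtain n k where nk: "n \<in> S" "k < n" "x + real k / real n \<in> F j" "real (Suc j) * real n \<le> a j"
      using cover by blast
    have "real k / real n \<in> \<rat>" by (intro Rats_divide) auto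
    then have "x + real k / real n \<notin> Z" using Z_shift False by blast
    then have "real (Suc j) * real n \<le> f (x + real k / real n)"
      using g_ge nk(3,4) by (force simp: f_def)
    then have "real (Suc j) \<le> f (x + real k / real n) / real n" using nk(2) by (simp add: field_simps)
    also have "\<dots> \<le> riemann_sum n f x" using f_nonneg nk(2) by (rule riemann_sum_ge_term)
    finally have "real (Suc j) \<le> riemann_sum n f x" .
    moreover have "C < real (Suc j)" unfolding j_def by linarith
    ultimately show ?thesis using nk(1) by (intro bexI[of _ n]) linarith+
  qed
  ultimately show ?thesis by blast
qed

section \<open>From unboundedness to divergence\<close>

theorem theorem1:
  fixes d :: nat and p :: "nat \<Rightarrow> nat" and n :: "nat \<Rightarrow> nat" and \<phi> :: "real \<Rightarrow> real"
  assumes "d \<ge> 1"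
    and "\<And>i. i \<in> {1..d} \<Longrightarrow> prime (p i)"
    and "inj_on p {1..d}"
    and "strict_mono n"
    and "range n = {\<Prod>i=1..d. p i ^ k i | k :: nat \<Rightarrow> nat. True}"
    and "mono_on {0..} \<phi>"
    and "\<And>x. x \<ge> 0 \<Longrightarrow> \<phi> x \<ge> 0"
    and "((\<lambda>x. \<phi> x / (x * ln x ^ (d - 1))) \<longlongrightarrow> 0) at_top"
  shows "\<exists>f \<in> L_class \<phi>. \<forall>x. \<not> convergent (\<lambda>k. riemann_sum (n k) f x)"
proof -
  define S where "S = {\<Prod>i=1..d. p i ^ k i | k :: nat \<Rightarrow> nat. True}"
  have rng: "range n = S" unfolding S_def by (rule assms(5))
  have "infinite S"
    unfolding rng[symmetric] using assms(4) by (intro range_inj_infinite strict_mono_imp_inj_on)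
  then have "\<exists>f \<in> L_class \<phi>. \<forall>x C. \<exists>m\<in>S. riemann_sum m f x > C"
  proof (rule everywhere_unbounded_riemann_sums[OF _ assms(6,7)])
    show "\<exists>a F B. spike \<phi> S A \<epsilon> a F B" if "A > 0" "\<epsilon> > 0" for A \<epsilon>
      unfolding S_def by (rule single_scale[OF assms(1-3,7,8) that])
  qed
  then obtain f where f: "f \<in> L_class \<phi>" "\<And>x C. \<exists>m\<in>S. riemann_sum m f x > C"
    by blast
  have "\<not> convergent (\<lambda>k. riemann_sum (n k) f x)" for x
  proof
    assume "convergent (\<lambda>k. riemann_sum (n k) f x)"
    then have "Bseq (\<lambda>k. riemann_sum (n k) f x)" by (rule convergent_imp_Bseq)
    then obtain C where C: "\<And>k. norm (riemann_sum (n k) f x) \<le> C" by (auto simp: Bseq_def)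
    obtain m where m: "m \<in> S" "riemann_sum m f x > C" using f(2) by blast
    then obtain k where "m = n k" unfolding rng[symmetric] by blast
    with m(2) C[of k] show False by simp
  qed
  with f(1) show ?thesis by blast
qed

end
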